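(* For real $\beta$ with $|\beta|<\sqrt{3}/2$, let $\mathcal{A}(\beta)\subset\mathbb{C}$ be the attractor of the iterated function system $\{f^{(0)},f^{(1)}\}$ on $\mathbb{C}$ given by $$f^{(0)}(z)=tz,\qquad f^{(1)}(z)=(1-t)z+t,\qquad t=\tfrac12+\mathrm{i}\beta$$ (the de Casteljau IFS for the Bézier curve with control points $0$ and $1$). Let $\mathrm{g}:\mathbb{C}\times\mathbb{R}\to\mathbb{C}$ be the scaling map $\mathrm{g}(z,\gamma)=\operatorname{Re}(z)+\gamma\,\mathrm{i}\,\operatorname{Im}(z)$, and write $\mathrm{g}(A,\gamma)=\{\mathrm{g}(z,\gamma): z\in A\}$ for $A\subset\mathbb{C}$. Then $$\lim_{\beta\to 0}\mathrm{d}_H\bigl(\mathrm{g}(\mathcal{A}(\beta),(2\beta)^{-1}),\mathcal{T}\bigr)=0,$$ where $\mathcal{T}=\{x+\mathrm{i}\,\mathrm{T}(x): x\in[0,1]\}$ is the graph of the Takagi function $\mathrm{T}$ and $\mathrm{d}_H$ is the Hausdorff distance between nonempty compact subsets of $\mathbb{C}$.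
   Context: The Takagi function is $\mathrm{T}(x)=\sum_{n=0}^{\infty}\sigma(2^nx)/2^n$ for $x\in[0,1]$, where $\sigma(x)=\min_{n\in\mathbb{Z}}|x-n|$ is the distance from $x$ to the nearest integer. The attractor of the IFS is the unique nonempty compact set $\mathcal{A}\subset\mathbb{C}$ with $\mathcal{A}=f^{(0)}(\mathcal{A})\cup f^{(1)}(\mathcal{A})$; it exists for $|\beta|<\sqrt3/2$ because then $|t|=|1-t|<1$ and both maps are contractions. The limit is over real $\beta\neq 0$. *)

theory Defs
  imports "HOL-Analysis.Analysis"
begin

subsection \<open>The Takagi function\<close>

text \<open>The infimum is attained (at \<open>round x\<close>), see \<open>dist_nearest_int_attained\<close> below,
  so it is the minimum.\<close>

definition dist_nearest_int :: "real \<Rightarrow> real" where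
  "dist_nearest_int x = (INF n::int. \<bar>x - of_int n\<bar>)"

definition takagi :: "real \<Rightarrow> real" where
  "takagi x = (\<Sum>n. dist_nearest_int (2 ^ n * x) / 2 ^ n)"

definition takagi_graph :: "complex set" where
  "takagi_graph = {complex_of_real x + \<i> * complex_of_real (takagi x) | x. x \<in> {0..1}}"

lemma dist_nearest_int_attained: "dist_nearest_int x = \<bar>x - of_int (round x)\<bar>"
  unfolding dist_nearest_int_def
  by (rule cInf_eq_minimum) (auto simp: round_diff_minimal)

lemma takagi_summable: "summable (\<lambda>n. dist_nearest_int (2 ^ n * x) / 2 ^ n)"
proof (rule summable_comparison_test')
  show "summable (\<lambda>n. (1/2::real) ^ n)" by (rule summable_geometric) simp
  fix n :: nat
  have "\<bar>y - of_int (round y)\<bar> \<le> 1" for y :: real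
    using of_int_round_abs_le[of y] by (simp add: abs_minus_commute)
  then show "norm (dist_nearest_int (2 ^ n * x) / 2 ^ n) \<le> (1/2) ^ n"
    unfolding dist_nearest_int_attained by (simp add: power_divide divide_right_mono)
qed

subsection \<open>Iterated function systems\<close>

text \<open>The attractor of the system \<open>{f, g}\<close>. The description is meaningful (exactly one such
  set exists) when both maps are contractions of a nonempty complete space.\<close>

definition ifs_attractor :: "('a::metric_space \<Rightarrow> 'a) \<Rightarrow> ('a \<Rightarrow> 'a) \<Rightarrow> 'a set" where
  "ifs_attractor f g = (THE A. compact A \<and> A \<noteq> {} \<and> A = f ` A \<union> g ` A)"

definition casteljau_param :: "real \<Rightarrow> complex" where
  "casteljau_param \<beta> = 1 / 2 + \<i> * complex_of_real \<beta>"

definition casteljau0 :: "complex \<Rightarrow> complex \<Rightarrow> complex" where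
  "casteljau0 t z = t * z"

definition casteljau1 :: "complex \<Rightarrow> complex \<Rightarrow> complex" where
  "casteljau1 t z = (1 - t) * z + t"

definition casteljau_attractor :: "real \<Rightarrow> complex set" where
  "casteljau_attractor \<beta> =
     ifs_attractor (casteljau0 (casteljau_param \<beta>)) (casteljau1 (casteljau_param \<beta>))"

subsection \<open>Scaling and Hausdorff distance\<close>

definition im_scale :: "complex \<Rightarrow> real \<Rightarrow> complex" where
  "im_scale z \<gamma> = complex_of_real (Re z) + complex_of_real \<gamma> * \<i> * complex_of_real (Im z)"

text \<open>Only intended for nonempty bounded sets; otherwise the real suprema carry no meaning.\<close>

definition hausdorff_dist :: "'a::metric_space set \<Rightarrow> 'a set \<Rightarrow> real" where
  "hausdorff_dist A B = max (SUP a\<in>A. infdist a B) (SUP b\<in>B. infdist b A)"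

end

theory Submission
  imports Defs
begin

text \<open>Conjugating the de Casteljau maps by \<open>z \<mapsto> Re z + \<i> Im z / (4 \<beta>)\<close> gives affine maps
  that depend polynomially on \<open>\<beta>\<close> and contract by \<open>3/4\<close> when \<open>\<bar>\<beta>\<bar> \<le> 1/4\<close>. At \<open>\<beta> = 0\<close> they
  are the maps for which the Takagi functional equation says that the graph of \<open>takagi\<close>, with heights
  halved, is invariant. A bounded invariant set of one contracting system is as close to a bounded
  invariant set of another as the maps of the two systems are to each other on the latter set, up to a
  factor depending on the contraction ratio, so the distance is \<open>O(\<beta>\<^sup>2)\<close>. Halving the heights is what
  makes the maps Euclidean contractions at \<open>\<beta> = 0\<close>.\<close>

section \<open>Distance estimates between invariant sets of two systems\<close>

lemma bdd_above_infdist_image: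
  assumes "bounded A"
  shows "bdd_above ((\<lambda>x. infdist x B) ` A)"
proof (cases "B = {}")
  case False
  then obtain b where b: "b \<in> B" by blast
  obtain e where "\<forall>a\<in>A. dist b a \<le> e"
    using assms bounded_any_center[of A b] by blast
  then show ?thesis
    by (intro bdd_aboveI2[of _ _ e]) (metis b dist_commute infdist_le order_trans)
qed (auto simp: infdist_def intro!: bdd_aboveI2)

text \<open>The supremum \<open>d\<close> of \<open>infdist x B\<close> over \<open>A\<close> is
  finite because \<open>A\<close> is bounded, and the hypothesis gives
  \<open>d \<le> c * d + e\<close>. Finiteness is what allows solving this for
  \<open>d\<close>.\<close>

lemma infdist_le_of_self_improving:
  assumes A: "bounded A" and c: "0 \<le> c" "c < 1"
    and step: "\<And>x. x \<in> A \<Longrightarrow> \<exists>y\<in>A. infdist x B \<le> c * infdist y B + e"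
    and x: "x \<in> A"
  shows "infdist x B \<le> e / (1 - c)"
proof -
  define d where "d = (SUP x\<in>A. infdist x B)"
  have up: "infdist y B \<le> d" if "y \<in> A" for y
    unfolding d_def using that bdd_above_infdist_image[OF A] by (rule cSUP_upper)
  have "infdist y B \<le> c * d + e" if y: "y \<in> A" for y
  proof -
    obtain z where z: "z \<in> A" "infdist y B \<le> c * infdist z B + e"
      using step[OF y] by blast
    then show ?thesis using mult_left_mono[OF up[OF z(1)] c(1)] by linarith
  qed
  then have "d \<le> c * d + e"
    unfolding d_def using x by (intro cSUP_least) auto
  then have "d \<le> e / (1 - c)"
    using c by (simp add: field_simps)
  then show ?thesis using up[OF x] by linarith
qed

text \<open>Take the infimum over \<open>b\<close> in the hypothesis. This form lets a pointwise
  Lipschitz estimate pass to \<open>infdist\<close> even when no nearest point of \<open>B\<close>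
  exists.\<close>

lemma infdist_le_affine:
  assumes c: "0 \<le> c" and B: "B \<noteq> {}"
    and le: "\<And>b. b \<in> B \<Longrightarrow> infdist y B' \<le> c * dist x b + e"
  shows "infdist y B' \<le> c * infdist x B + e"
\<comment> \<open>The infimum is reached by dividing by \<open>c\<close>, so \<open>c = 0\<close> is
  separate; there any single \<open>b\<close> gives the bound.\<close>
proof (cases "c = 0")
  case True
  then show ?thesis using B le by auto
next
  case False
  have "(infdist y B' - e) / c \<le> infdist x B"
    unfolding infdist_notempty[OF B]
    using B le c False by (intro cINF_greatest) (auto simp: field_simps)
  then show ?thesis using c False by (simp add: field_simps)
qed

text \<open>Invariance writes each point as an image of a point of the same set. The detour through
  \<open>f0 b\<close> (or \<open>f1 b\<close>) costs \<open>e\<close> and then contracts by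
  \<open>c\<close>, so \<open>est\<close> yields the self-improving inequality in both directions,
  the second with the two points exchanged.\<close>

lemma invariant_sets_close:
  fixes f0 f1 g0 g1 :: "'a::metric_space \<Rightarrow> 'a"
  assumes A: "bounded A" "A \<noteq> {}" "A = f0 ` A \<union> f1 ` A"
    and B: "bounded B" "B \<noteq> {}" "B = g0 ` B \<union> g1 ` B"
    and lip: "c-lipschitz_on UNIV f0" "c-lipschitz_on UNIV f1" and c: "c < 1"
    and close: "\<And>b. b \<in> B \<Longrightarrow> dist (f0 b) (g0 b) \<le> e" "\<And>b. b \<in> B \<Longrightarrow> dist (f1 b) (g1 b) \<le> e"
  shows "a \<in> A \<Longrightarrow> infdist a B \<le> e / (1 - c)" and "b \<in> B \<Longrightarrow> infdist b A \<le> e / (1 - c)"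
proof -
  have c0: "0 \<le> c" using lip(1) by (rule lipschitz_on_nonneg)
  have est: "dist (f0 x) (g0 b) \<le> c * dist x b + e" "dist (f1 x) (g1 b) \<le> c * dist x b + e"
    if "b \<in> B" for x b
    using close[OF that] lipschitz_onD[OF lip(1), of x b] lipschitz_onD[OF lip(2), of x b]
      dist_triangle[of "f0 x" "g0 b" "f0 b"] dist_triangle[of "f1 x" "g1 b" "f1 b"] by auto
  have inB: "g0 b \<in> B" "g1 b \<in> B" if "b \<in> B" for b using B(3) that by blast+
  have inA: "f0 a \<in> A" "f1 a \<in> A" if "a \<in> A" for a using A(3) that by blast+
  show "infdist a B \<le> e / (1 - c)" if "a \<in> A"
  proof (rule infdist_le_of_self_improving[OF A(1) c0 c _ that])
    fix x assume "x \<in> A"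
    then obtain y where y: "y \<in> A" "x = f0 y \<or> x = f1 y" using A(3) by blast
    have "infdist x B \<le> c * infdist y B + e"
      using y(2) by (intro infdist_le_affine[OF c0 B(2)]) (metis infdist_le2 est inB)
    with y(1) show "\<exists>y\<in>A. infdist x B \<le> c * infdist y B + e" by blast
  qed
  show "infdist b A \<le> e / (1 - c)" if "b \<in> B"
  proof (rule infdist_le_of_self_improving[OF B(1) c0 c _ that])
    fix x assume "x \<in> B"
    then obtain y where y: "y \<in> B" "x = g0 y \<or> x = g1 y" using B(3) by blast
    have "infdist x A \<le> c * infdist y A + e"
      using y by (intro infdist_le_affine[OF c0 A(2)]) (metis infdist_le2 est inA dist_commute)
    with y(1) show "\<exists>y\<in>B. infdist x A \<le> c * infdist y A + e" by blast
  qed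
qed

text \<open>Comparing the system with itself allows \<open>e = 0\<close>, so each point of one set
  has distance 0 from the other, which is closed.\<close>

lemma compact_invariant_set_unique:
  fixes f g :: "'a::metric_space \<Rightarrow> 'a"
  assumes A: "compact A" "A \<noteq> {}" "A = f ` A \<union> g ` A"
    and B: "compact B" "B \<noteq> {}" "B = f ` B \<union> g ` B"
    and lip: "c-lipschitz_on UNIV f" "c-lipschitz_on UNIV g" "c < 1"
  shows "A = B"
proof -
  note close = invariant_sets_close[OF compact_imp_bounded[OF A(1)] A(2,3)
    compact_imp_bounded[OF B(1)] B(2,3) lip, of 0]
  have "a \<in> B" if "a \<in> A" for a
    using close(1)[OF _ _ that] in_closed_iff_infdist_zero[OF compact_imp_closed[OF B(1)] B(2), of a]
      infdist_nonneg[of a B] by simp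
  moreover have "b \<in> A" if "b \<in> B" for b
    using close(2)[OF _ _ that] in_closed_iff_infdist_zero[OF compact_imp_closed[OF A(1)] A(2), of b]
      infdist_nonneg[of b A] by simp
  ultimately show ?thesis by blast
qed

section \<open>Existence of the attractor\<close>

text \<open>The iterates of the Hutchinson operator \<open>H\<close> on \<open>K\<close> form a
  decreasing sequence of nonempty compact sets, and their intersection is invariant.\<close>

lemma compact_trapping_set_has_invariant:
  fixes f g :: "'a::heine_borel \<Rightarrow> 'a"
  assumes K: "compact K" "K \<noteq> {}" "f ` K \<subseteq> K" "g ` K \<subseteq> K"
    and cont: "continuous_on UNIV f" "continuous_on UNIV g"
  shows "\<exists>A. compact A \<and> A \<noteq> {} \<and> A = f ` A \<union> g ` A"
proof -
  define H where "H = (\<lambda>S. f ` S \<union> g ` S)"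
  define N where "N = (\<lambda>n. (H ^^ n) K)"
  define A where "A = (\<Inter>n. N n)"
  have N_Suc: "N (Suc n) = f ` N n \<union> g ` N n" for n
    by (simp add: N_def H_def)
  have N0: "N 0 = K" by (simp add: N_def)
  have compN: "compact (N n)" for n
    by (induction n)
      (auto simp: N0 N_Suc K intro!: compact_Un compact_continuous_image continuous_on_subset[OF cont(1)]
        continuous_on_subset[OF cont(2)])
  have neN: "N n \<noteq> {}" for n
    by (induction n) (auto simp: N0 N_Suc K)
  have sub: "N (Suc n) \<subseteq> N n" for n
  proof (induction n)
    case 0
    then show ?case using K by (auto simp: N0 N_Suc)
  next
    case (Suc n)
    then show ?case unfolding N_Suc[of "Suc n"] unfolding N_Suc[of n] by blast
  qed
  have dec: "N n \<subseteq> N m" if "m \<le> n" for m n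
    using lift_Suc_antimono_le[of N, OF sub that] .
  \<comment> \<open>With \<open>h\<close> one of the two maps, a point of this intersection is a
    preimage of \<open>x\<close> lying in \<open>A\<close>.\<close>
  have nest: "(\<Inter>n. N n \<inter> h -` {x}) \<noteq> {}"
    if "\<And>n. N n \<inter> h -` {x} \<noteq> {}" and "continuous_on UNIV h" for h :: "'a \<Rightarrow> 'a" and x
  proof (rule compact_nest)
    have "closed (h -` {x})" using that(2) by (intro closed_vimage) auto
    then show "compact (N n \<inter> h -` {x})" for n by (intro compact_Int_closed compN)
    show "N n \<inter> h -` {x} \<noteq> {}" for n by (fact that(1))
    show "N n \<inter> h -` {x} \<subseteq> N m \<inter> h -` {x}" if "m \<le> n" for m n
      using dec[OF that] by blast
  qed
  have "A \<noteq> {}"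
    unfolding A_def using compN neN dec by (rule compact_nest)
  moreover have "compact A"
    unfolding A_def using compN by (intro compact_Inter) auto
  moreover have "A = f ` A \<union> g ` A"
  proof
    show "f ` A \<union> g ` A \<subseteq> A"
    proof -
      have "f ` A \<union> g ` A \<subseteq> N n" for n
        using sub[of n] unfolding N_Suc A_def by blast
      then show ?thesis by (auto simp: A_def)
    qed
    show "A \<subseteq> f ` A \<union> g ` A"
    proof
      fix x assume x: "x \<in> A"
      \<comment> \<open>The map that hits \<open>x\<close> could change with the stage. But if both
        fibres became empty at some stages, both would be empty from \<open>max m n\<close> on,
        while \<open>x\<close> still has a preimage there.\<close>
      have "(\<forall>n. N n \<inter> f -` {x} \<noteq> {}) \<or> (\<forall>n. N n \<inter> g -` {x} \<noteq> {})"
      proof (rule ccontr)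
        assume "\<not> ?thesis"
        then obtain m n where mn: "N m \<inter> f -` {x} = {}" "N n \<inter> g -` {x} = {}" by blast
        have "x \<in> N (Suc (max m n))" using x by (auto simp: A_def)
        then show False
          using mn dec[of m "max m n"] dec[of n "max m n"] unfolding N_Suc by auto
      qed
      then have "(\<Inter>n. N n \<inter> f -` {x}) \<noteq> {} \<or> (\<Inter>n. N n \<inter> g -` {x}) \<noteq> {}"
        using nest cont by blast
      then show "x \<in> f ` A \<union> g ` A" by (auto simp: A_def)
    qed
  qed
  ultimately show ?thesis by blast
qed

text \<open>The condition on \<open>R\<close> is \<open>dist p (f p) + c * R \<le> R\<close> solved
  for \<open>R\<close>, and the left side bounds the distance from \<open>p\<close> to the image of
  any point of the ball.\<close>

lemma lipschitz_cball_invariant: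
  fixes f :: "'a::metric_space \<Rightarrow> 'a"
  assumes lip: "c-lipschitz_on UNIV f" and c: "c < 1" and R: "dist p (f p) / (1 - c) \<le> R"
  shows "f ` cball p R \<subseteq> cball p R"
proof clarsimp
  fix x assume x: "dist p x \<le> R"
  have "dist p (f x) \<le> dist p (f p) + c * dist p x"
    using lipschitz_onD[OF lip, of p x] dist_triangle[of p "f x" "f p"] by auto
  also have "\<dots> \<le> (1 - c) * R + c * R"
    using R c x lipschitz_on_nonneg[OF lip] by (intro add_mono mult_left_mono) (auto simp: field_simps)
  finally show "dist p (f x) \<le> R" by (simp add: algebra_simps)
qed

text \<open>Existence and uniqueness discharge the definite description. The trapping set is a
  closed ball around an arbitrary \<open>p\<close>, its radius taken as a maximum so that it serves
  both maps; it is compact by the Heine-Borel property.\<close>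

lemma ifs_attractor_works:
  fixes f g :: "'a::heine_borel \<Rightarrow> 'a"
  assumes lip: "c-lipschitz_on UNIV f" "c-lipschitz_on UNIV g" and c: "c < 1"
  shows "compact (ifs_attractor f g)" "ifs_attractor f g \<noteq> {}"
    "ifs_attractor f g = f ` ifs_attractor f g \<union> g ` ifs_attractor f g"
proof -
  fix p :: 'a
  define R where "R = max (dist p (f p)) (dist p (g p)) / (1 - c)"
  have "R \<ge> 0" using c by (simp add: R_def le_max_iff_disj)
  then have ne: "cball p R \<noteq> {}" by simp
  have R: "dist p (f p) / (1 - c) \<le> R" "dist p (g p) / (1 - c) \<le> R"
    using c by (auto simp: R_def intro!: divide_right_mono)
  have "\<exists>A. compact A \<and> A \<noteq> {} \<and> A = f ` A \<union> g ` A"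
    using compact_cball ne lipschitz_cball_invariant[OF lip(1) c R(1)]
      lipschitz_cball_invariant[OF lip(2) c R(2)] lip[THEN lipschitz_on_continuous_on]
    by (rule compact_trapping_set_has_invariant)
  then have "\<exists>!A. compact A \<and> A \<noteq> {} \<and> A = f ` A \<union> g ` A"
    by (rule ex_ex1I) (elim conjE, rule compact_invariant_set_unique[OF _ _ _ _ _ _ lip c])
  from theI'[OF this, folded ifs_attractor_def]
  show "compact (ifs_attractor f g)" "ifs_attractor f g \<noteq> {}"
    "ifs_attractor f g = f ` ifs_attractor f g \<union> g ` ifs_attractor f g"
    by (rule conjunct1, rule conjunct2[THEN conjunct1], rule conjunct2[THEN conjunct2])
qed

section \<open>Lipschitz images and the Hausdorff distance\<close>

lemma infdist_image_le:
  assumes lip: "L-lipschitz_on UNIV s" and B: "B \<noteq> {}"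
  shows "infdist (s x) (s ` B) \<le> L * infdist x B"
proof -
  have "infdist (s x) (s ` B) \<le> L * dist x b + 0" if "b \<in> B" for b
    using lipschitz_onD[OF lip, of x b] that by (intro infdist_le2[of "s b"]) auto
  from infdist_le_affine[OF lipschitz_on_nonneg[OF lip] B this] show ?thesis by simp
qed

text \<open>The uniform bound \<open>d\<close> makes the real suprema genuine, so a single point of
  \<open>A\<close> already shows nonnegativity.\<close>

lemma hausdorff_dist_bounds:
  assumes ne: "A \<noteq> {}" "B \<noteq> {}"
    and le: "\<And>a. a \<in> A \<Longrightarrow> infdist a B \<le> d" "\<And>b. b \<in> B \<Longrightarrow> infdist b A \<le> d"
  shows "0 \<le> hausdorff_dist A B" "hausdorff_dist A B \<le> d"
proof -
  obtain a where a: "a \<in> A" using ne by blast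
  have "0 \<le> infdist a B" by (rule infdist_nonneg)
  also have "\<dots> \<le> (SUP a\<in>A. infdist a B)"
    using a le(1) by (intro cSUP_upper bdd_aboveI2) auto
  finally show "0 \<le> hausdorff_dist A B" by (simp add: hausdorff_dist_def)
  show "hausdorff_dist A B \<le> d"
    using ne le by (auto simp: hausdorff_dist_def intro!: cSUP_least)
qed

section \<open>The functional equations of the Takagi function\<close>

lemma dist_nearest_int_nonneg: "0 \<le> dist_nearest_int x"
  by (simp add: dist_nearest_int_attained)

lemma dist_nearest_int_le_half: "dist_nearest_int x \<le> 1 / 2"
  using of_int_round_abs_le[of x] by (simp add: dist_nearest_int_attained abs_minus_commute)

lemma dist_nearest_int_add_int: "dist_nearest_int (x + of_int k) = dist_nearest_int x"
proof -
  have "round (x + of_int k) = round x + k"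
    using floor_add_int[of "x + 1 / 2" k] by (simp add: round_def add_ac)
  then show ?thesis by (simp add: dist_nearest_int_attained)
qed

lemma dist_nearest_int_minus: "dist_nearest_int (- x) = dist_nearest_int x"
proof -
  have "(\<lambda>n::int. \<bar>- x - of_int n\<bar>) = (\<lambda>n. \<bar>x - of_int n\<bar>) \<circ> uminus" by (auto simp: abs_if)
  moreover have "range (uminus :: int \<Rightarrow> int) = UNIV" by (rule surj_uminus)
  ultimately show ?thesis by (simp only: dist_nearest_int_def image_comp[symmetric])
qed

lemma dist_nearest_int_eq_self:
  assumes "0 \<le> x" "x \<le> 1 / 2"
  shows "dist_nearest_int x = x"
proof (rule antisym)
  show "dist_nearest_int x \<le> x"
    using round_diff_minimal[of x 0] assms by (simp add: dist_nearest_int_attained)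
  show "x \<le> dist_nearest_int x"
    unfolding dist_nearest_int_attained
  proof (cases "round x \<le> 0")
    case True
    then have "real_of_int (round x) \<le> 0" by simp
    then show "x \<le> \<bar>x - of_int (round x)\<bar>" by linarith
  next
    case False
    then have "1 \<le> real_of_int (round x)" by linarith
    then show "x \<le> \<bar>x - of_int (round x)\<bar>" using assms by linarith
  qed
qed

lemma dist_nearest_int_upper_half:
  assumes "1 / 2 \<le> x" "x \<le> 1"
  shows "dist_nearest_int x = 1 - x"
proof -
  have "dist_nearest_int x = dist_nearest_int (- (1 - x) + of_int 1)" by simp
  also have "\<dots> = dist_nearest_int (1 - x)"
    by (simp only: dist_nearest_int_add_int dist_nearest_int_minus)
  also have "\<dots> = 1 - x" using assms by (intro dist_nearest_int_eq_self) auto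
  finally show ?thesis .
qed

lemma takagi_add_1: "takagi (x + 1) = takagi x"
proof -
  have "dist_nearest_int (2 ^ n * (x + 1)) = dist_nearest_int (2 ^ n * x)" for n :: nat
    using dist_nearest_int_add_int[of "2 ^ n * x" "2 ^ n"] by (simp add: algebra_simps)
  then show ?thesis by (simp add: takagi_def)
qed

lemma takagi_bounds: "0 \<le> takagi x" "takagi x \<le> 1"
proof -
  show "0 \<le> takagi x"
    unfolding takagi_def by (intro suminf_nonneg takagi_summable) (simp add: dist_nearest_int_nonneg)
  \<comment> \<open>Termwise majorant with sum 1. The true maximum of the Takagi function is 2/3,
    but any uniform bound serves the limit.\<close>
  have half: "(\<lambda>n. (1/2) * (1/2) ^ n :: real) sums ((1/2) * (1 / (1 - 1/2)))"
    by (intro sums_mult geometric_sums) simp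
  have "takagi x \<le> (\<Sum>n. (1/2) * (1/2) ^ n)"
    unfolding takagi_def
  proof (intro suminf_le takagi_summable)
    show "dist_nearest_int (2 ^ n * x) / 2 ^ n \<le> (1/2) * (1/2) ^ n" for n
      using divide_right_mono[OF dist_nearest_int_le_half[of "2 ^ n * x"], of "2 ^ n"]
      by (simp add: power_divide)
  qed (use half in \<open>rule sums_summable\<close>)
  then show "takagi x \<le> 1" using sums_unique[OF half] by simp
qed

text \<open>Splitting off the term \<open>n = 0\<close> leaves half the series at \<open>y\<close>;
  this is the source of the self-affinity of the graph.\<close>

lemma takagi_half: "takagi (y / 2) = dist_nearest_int (y / 2) + takagi y / 2"
proof -
  let ?a = "\<lambda>n. dist_nearest_int (2 ^ n * (y / 2)) / 2 ^ n"
  have "takagi (y / 2) = ?a 0 + (\<Sum>n. ?a (Suc n))"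
    unfolding takagi_def using suminf_split_head[OF takagi_summable[of "y / 2"]] by simp
  also have "(\<Sum>n. ?a (Suc n)) = (\<Sum>n. (1 / 2) * (dist_nearest_int (2 ^ n * y) / 2 ^ n))"
    by (simp add: mult.assoc)
  also have "\<dots> = takagi y / 2"
    unfolding takagi_def by (subst suminf_mult[OF takagi_summable]) simp
  finally show ?thesis by simp
qed

lemma takagi_left_half: "0 \<le> x \<Longrightarrow> x \<le> 1 \<Longrightarrow> takagi (x / 2) = (x + takagi x) / 2"
  using takagi_half[of x] dist_nearest_int_eq_self[of "x / 2"] by simp

lemma takagi_right_half: "0 \<le> x \<Longrightarrow> x \<le> 1 \<Longrightarrow> takagi ((x + 1) / 2) = (1 - x + takagi x) / 2"
  using takagi_half[of "x + 1"] dist_nearest_int_upper_half[of "(x + 1) / 2"]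
  unfolding takagi_add_1 by simp argo

section \<open>The rescaled de Casteljau maps\<close>

text \<open>The conjugate of \<open>casteljau0\<close> under the scaling by
  \<open>inverse (4 * \<beta>)\<close>, written so that it also makes sense at
  \<open>\<beta> = 0\<close>. The factor 4 instead of 2 turns the coefficient of \<open>Re w\<close>
  in the imaginary part into 1/4 rather than 1/2.\<close>

definition scaled0 :: "real \<Rightarrow> complex \<Rightarrow> complex" where
  "scaled0 \<beta> w = Complex (Re w / 2 - 4 * \<beta>\<^sup>2 * Im w) (Im w / 2 + Re w / 4)"

definition scaled1 :: "real \<Rightarrow> complex \<Rightarrow> complex" where
  "scaled1 \<beta> w = Complex ((Re w + 1) / 2 + 4 * \<beta>\<^sup>2 * Im w) (Im w / 2 + (1 - Re w) / 4)"

lemma im_scale_eq_Complex: "im_scale z \<gamma> = Complex (Re z) (\<gamma> * Im z)"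
  by (simp add: im_scale_def complex_eq_iff)

lemma im_scale_casteljau0:
  assumes "\<beta> \<noteq> 0"
  shows "im_scale (casteljau0 (casteljau_param \<beta>) z) (inverse (4 * \<beta>))
    = scaled0 \<beta> (im_scale z (inverse (4 * \<beta>)))"
  using assms
  by (simp add: im_scale_eq_Complex casteljau0_def casteljau_param_def scaled0_def
      field_simps power2_eq_square)

lemma im_scale_casteljau1:
  assumes "\<beta> \<noteq> 0"
  shows "im_scale (casteljau1 (casteljau_param \<beta>) z) (inverse (4 * \<beta>))
    = scaled1 \<beta> (im_scale z (inverse (4 * \<beta>)))"
  using assms
  by (simp add: im_scale_eq_Complex casteljau1_def casteljau_param_def scaled1_def
      field_simps power2_eq_square)

lemma norm_Complex_swap_le:
  assumes "\<bar>p\<bar> \<le> c" "\<bar>q\<bar> \<le> c"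
  shows "norm (Complex (p * Im w) (q * Re w)) \<le> c * norm w"
proof -
  have c: "0 \<le> c" using assms by linarith
  have sq: "p\<^sup>2 \<le> c\<^sup>2" "q\<^sup>2 \<le> c\<^sup>2"
    using assms c by (auto simp: abs_le_square_iff[symmetric])
  have "(p * Im w)\<^sup>2 + (q * Re w)\<^sup>2 \<le> c\<^sup>2 * (Im w)\<^sup>2 + c\<^sup>2 * (Re w)\<^sup>2"
    unfolding power_mult_distrib using sq by (intro add_mono mult_right_mono) auto
  also have "\<dots> = (c * norm w)\<^sup>2"
    by (simp add: power_mult_distrib cmod_power2 algebra_simps)
  finally show ?thesis
    using c by (simp add: cmod_def real_sqrt_le_iff' real_le_lsqrt)
qed

text \<open>The linear part is half the identity plus an antidiagonal matrix with entries of size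
  \<open>4 * \<beta>\<^sup>2\<close> and \<open>1 / 4\<close>. The bound on \<beta> keeps both at
  most 1/4, so the triangle inequality gives 1/2 + 1/4.\<close>

lemma lipschitz_scaled:
  assumes \<beta>: "\<bar>\<beta>\<bar> \<le> 1 / 4"
  shows "(3/4)-lipschitz_on UNIV (scaled0 \<beta>)" "(3/4)-lipschitz_on UNIV (scaled1 \<beta>)"
proof -
  have b2: "4 * \<beta>\<^sup>2 \<le> 1 / 4"
    using power_mono[OF \<beta>, of 2] by (simp add: power2_eq_square)
  have "dist (scaled0 \<beta> z) (scaled0 \<beta> w) \<le> 3/4 * dist z w" for z w
  proof -
    have "scaled0 \<beta> z - scaled0 \<beta> w
      = (z - w) / 2 + Complex (- (4 * \<beta>\<^sup>2) * Im (z - w)) (1 / 4 * Re (z - w))"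
      by (simp add: scaled0_def complex_eq_iff field_simps)
    then show ?thesis
      using norm_triangle_ineq[of "(z - w) / 2" "Complex (- (4 * \<beta>\<^sup>2) * Im (z - w)) (1 / 4 * Re (z - w))"]
        norm_Complex_swap_le[of "- (4 * \<beta>\<^sup>2)" "1 / 4" "1 / 4" "z - w"] b2
      by (simp add: dist_norm norm_divide)
  qed
  then show "(3/4)-lipschitz_on UNIV (scaled0 \<beta>)" by (intro lipschitz_onI) auto
  have "dist (scaled1 \<beta> z) (scaled1 \<beta> w) \<le> 3/4 * dist z w" for z w
  proof -
    have "scaled1 \<beta> z - scaled1 \<beta> w
      = (z - w) / 2 + Complex (4 * \<beta>\<^sup>2 * Im (z - w)) (- (1 / 4) * Re (z - w))"
      by (simp add: scaled1_def complex_eq_iff field_simps)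
    then show ?thesis
      using norm_triangle_ineq[of "(z - w) / 2" "Complex (4 * \<beta>\<^sup>2 * Im (z - w)) (- (1 / 4) * Re (z - w))"]
        norm_Complex_swap_le[of "4 * \<beta>\<^sup>2" "1 / 4" "- (1 / 4)" "z - w"] b2
      by (simp add: dist_norm norm_divide)
  qed
  then show "(3/4)-lipschitz_on UNIV (scaled1 \<beta>)" by (intro lipschitz_onI) auto
qed

lemma dist_scaled_0:
  "dist (scaled0 \<beta> w) (scaled0 0 w) = 4 * \<beta>\<^sup>2 * \<bar>Im w\<bar>"
  "dist (scaled1 \<beta> w) (scaled1 0 w) = 4 * \<beta>\<^sup>2 * \<bar>Im w\<bar>"
  by (simp_all add: dist_norm scaled0_def scaled1_def cmod_def abs_mult)

text \<open>Both \<open>t\<close> and \<open>1 - t\<close> have real part 1/2 and imaginary part at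
  most 1/4 in absolute value. This makes \<open>casteljau_attractor\<close> a genuine
  attractor.\<close>

lemma lipschitz_casteljau:
  assumes "\<bar>\<beta>\<bar> \<le> 1 / 4"
  shows "(3/4)-lipschitz_on UNIV (casteljau0 (casteljau_param \<beta>))"
    "(3/4)-lipschitz_on UNIV (casteljau1 (casteljau_param \<beta>))"
proof -
  let ?t = "casteljau_param \<beta>"
  have t: "norm ?t \<le> 3/4" "norm (1 - ?t) \<le> 3/4"
    using cmod_le[of ?t] cmod_le[of "1 - ?t"] assms by (auto simp: casteljau_param_def)
  show "(3/4)-lipschitz_on UNIV (casteljau0 ?t)"
    by (intro lipschitz_onI)
      (use mult_right_mono[OF t(1) norm_ge_zero] in
        \<open>auto simp: casteljau0_def dist_norm norm_mult simp flip: right_diff_distrib\<close>)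
  show "(3/4)-lipschitz_on UNIV (casteljau1 ?t)"
    by (intro lipschitz_onI)
      (use mult_right_mono[OF t(2) norm_ge_zero] in
        \<open>auto simp: casteljau1_def dist_norm norm_mult simp flip: right_diff_distrib\<close>)
qed

section \<open>The Takagi graph as invariant set of the limit system\<close>

text \<open>Heights are halved to match the scaling by \<open>inverse (4 * \<beta>)\<close> in place
  of \<open>inverse (2 * \<beta>)\<close>.\<close>

definition half_takagi_graph :: "complex set" where
  "half_takagi_graph = (\<lambda>x. Complex x (takagi x / 2)) ` {0..1}"

lemma im_scale_half_takagi_graph: "(\<lambda>z. im_scale z 2) ` half_takagi_graph = takagi_graph"
  by (auto simp: half_takagi_graph_def takagi_graph_def im_scale_eq_Complex image_image
      complex_eq_iff intro!: image_eqI)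

lemma Im_half_takagi_graph: "w \<in> half_takagi_graph \<Longrightarrow> \<bar>Im w\<bar> \<le> 1 / 2"
  using takagi_bounds by (auto simp: half_takagi_graph_def)

lemma bounded_half_takagi_graph: "bounded half_takagi_graph"
proof (rule boundedI)
  fix w assume w: "w \<in> half_takagi_graph"
  then have "\<bar>Re w\<bar> \<le> 1" by (auto simp: half_takagi_graph_def)
  then show "norm w \<le> 2" using cmod_le[of w] Im_half_takagi_graph[OF w] by linarith
qed

text \<open>By the functional equations the two maps send the point over \<open>x\<close> to the
  points over \<open>x / 2\<close> and \<open>(x + 1) / 2\<close>, and these abscissae together fill
  the unit interval.\<close>

lemma half_takagi_graph_invariant:
  "half_takagi_graph = scaled0 0 ` half_takagi_graph \<union> scaled1 0 ` half_takagi_graph"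
proof -
  let ?p = "\<lambda>x. Complex x (takagi x / 2)"
  have s0: "scaled0 0 (?p x) = ?p (x / 2)" if "x \<in> {0..1}" for x
    using that by (simp add: scaled0_def takagi_left_half field_simps)
  have s1: "scaled1 0 (?p x) = ?p ((x + 1) / 2)" if "x \<in> {0..1}" for x
    using that takagi_right_half[of x] by (simp add: scaled1_def) argo
  have halves: "{0..1::real} = (\<lambda>x. x / 2) ` {0..1} \<union> (\<lambda>x. (x + 1) / 2) ` {0..1}"
  proof -
    have "x \<in> (\<lambda>x. x / 2) ` {0..1} \<union> (\<lambda>x. (x + 1) / 2) ` {0..1}" if "x \<in> {0..1}" for x :: real
    proof (cases "x \<le> 1 / 2")
      case True
      then show ?thesis using that by (intro UnI1 image_eqI[of _ _ "2 * x"]) auto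
    next
      case False
      then show ?thesis using that by (intro UnI2 image_eqI[of _ _ "2 * x - 1"]) auto
    qed
    then show ?thesis by (intro equalityI subsetI) (blast, auto)
  qed
  have "half_takagi_graph = (\<lambda>x. ?p (x / 2)) ` {0..1} \<union> (\<lambda>x. ?p ((x + 1) / 2)) ` {0..1}"
    unfolding half_takagi_graph_def by (subst halves) (simp only: image_Un image_image)
  also have "(\<lambda>x. ?p (x / 2)) ` {0..1} = scaled0 0 ` half_takagi_graph"
    unfolding half_takagi_graph_def image_image by (intro image_cong refl) (simp only: s0)
  also have "(\<lambda>x. ?p ((x + 1) / 2)) ` {0..1} = scaled1 0 ` half_takagi_graph"
    unfolding half_takagi_graph_def image_image by (intro image_cong refl) (simp only: s1)
  finally show ?thesis .
qed

section \<open>Quadratic rate and the limit\<close>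

text \<open>The constant: the maps differ by at most \<open>4 * \<beta>\<^sup>2 * (1 / 2)\<close> on
  the half graph, division by \<open>1 - 3 / 4\<close> gives \<open>8 * \<beta>\<^sup>2\<close>, and
  restoring the heights doubles this.\<close>

lemma hausdorff_dist_casteljau_takagi:
  assumes \<beta>: "\<beta> \<noteq> 0" "\<bar>\<beta>\<bar> \<le> 1 / 4"
  defines "D \<equiv> hausdorff_dist
    ((\<lambda>z. im_scale z (inverse (2 * \<beta>))) ` casteljau_attractor \<beta>) takagi_graph"
  shows "0 \<le> D" "D \<le> 16 * \<beta>\<^sup>2"
proof -
  define A where "A = casteljau_attractor \<beta>"
  define s where "s = (\<lambda>z. im_scale z (inverse (4 * \<beta>)))"
  let ?d = "\<lambda>z. im_scale z 2"
  have c: "3 / 4 < (1::real)" by simp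
  note attr = ifs_attractor_works[OF lipschitz_casteljau[OF \<beta>(2)] c, folded casteljau_attractor_def A_def]
  have cont: "continuous_on A s"
    unfolding s_def im_scale_def by (intro continuous_intros)
  have bdd: "bounded (s ` A)"
    using attr(1) by (intro compact_imp_bounded compact_continuous_image cont) simp
  have ne: "s ` A \<noteq> {}" using attr(2) by simp
  \<comment> \<open>The conjugation carries the invariance of the attractor over to its scaled
    image.\<close>
  have inv: "s ` A = scaled0 \<beta> ` s ` A \<union> scaled1 \<beta> ` s ` A"
  proof -
    have conj: "s (casteljau0 (casteljau_param \<beta>) z) = scaled0 \<beta> (s z)"
      "s (casteljau1 (casteljau_param \<beta>) z) = scaled1 \<beta> (s z)" for z
      unfolding s_def using \<beta>(1) by (rule im_scale_casteljau0, rule im_scale_casteljau1)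
    have "s ` A = s ` (casteljau0 (casteljau_param \<beta>) ` A \<union> casteljau1 (casteljau_param \<beta>) ` A)"
      by (rule arg_cong[OF attr(3)])
    also have "\<dots> = scaled0 \<beta> ` s ` A \<union> scaled1 \<beta> ` s ` A"
      by (simp only: image_Un image_image conj)
    finally show ?thesis .
  qed
  have T: "half_takagi_graph \<noteq> {}" by (simp add: half_takagi_graph_def)
  have close: "dist (scaled0 \<beta> w) (scaled0 0 w) \<le> 2 * \<beta>\<^sup>2"
    "dist (scaled1 \<beta> w) (scaled1 0 w) \<le> 2 * \<beta>\<^sup>2" if "w \<in> half_takagi_graph" for w
    using mult_left_mono[OF Im_half_takagi_graph[OF that], of "4 * \<beta>\<^sup>2"]
    by (simp_all add: dist_scaled_0)
  note close_sets = invariant_sets_close[of "s ` A" "scaled0 \<beta>" "scaled1 \<beta>" half_takagi_graph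
      "scaled0 0" "scaled1 0" "3 / 4" "2 * \<beta>\<^sup>2",
      OF bdd ne inv bounded_half_takagi_graph T half_takagi_graph_invariant
        lipschitz_scaled[OF \<beta>(2)] c]
  have near: "infdist a half_takagi_graph \<le> 2 * \<beta>\<^sup>2 / (1 - 3 / 4)" if "a \<in> s ` A" for a
    by (rule close_sets(1)[OF _ _ that]) (erule close)+
  have near': "infdist b (s ` A) \<le> 2 * \<beta>\<^sup>2 / (1 - 3 / 4)" if "b \<in> half_takagi_graph" for b
    by (rule close_sets(2)[OF _ _ that]) (erule close)+
  have lip: "2-lipschitz_on UNIV ?d"
  proof (rule lipschitz_onI)
    fix z w :: complex
    have "(dist (?d z) (?d w))\<^sup>2 = (Re z - Re w)\<^sup>2 + (2 * (Im z - Im w))\<^sup>2"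
      by (simp add: im_scale_eq_Complex dist_norm cmod_power2)
    also have "\<dots> \<le> (2 * dist z w)\<^sup>2"
      unfolding power_mult_distrib by (simp add: dist_norm cmod_power2)
    finally have "(dist (?d z) (?d w))\<^sup>2 \<le> (2 * dist z w)\<^sup>2" .
    then show "dist (?d z) (?d w) \<le> 2 * dist z w"
      by (rule power2_le_imp_le) simp
  qed simp
  \<comment> \<open>The scaling in the claim is the working scaling followed by the vertical
    doubling \<open>?d\<close>.\<close>
  have eqs: "(\<lambda>z. im_scale z (inverse (2 * \<beta>))) ` A = ?d ` s ` A"
    using \<beta>(1) by (simp add: s_def image_image im_scale_eq_Complex field_simps)
  have D: "D = hausdorff_dist (?d ` s ` A) (?d ` half_takagi_graph)"
    by (simp only: D_def im_scale_half_takagi_graph eqs flip: A_def)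
  have 1: "infdist a (?d ` half_takagi_graph) \<le> 16 * \<beta>\<^sup>2" if a: "a \<in> ?d ` s ` A" for a
  proof -
    obtain a' where a': "a' \<in> s ` A" "a = ?d a'" using a by blast
    then show ?thesis using infdist_image_le[OF lip T, of a'] near[OF a'(1)] by simp
  qed
  have 2: "infdist b (?d ` s ` A) \<le> 16 * \<beta>\<^sup>2" if b: "b \<in> ?d ` half_takagi_graph" for b
  proof -
    obtain b' where b': "b' \<in> half_takagi_graph" "b = ?d b'" using b by blast
    then show ?thesis using infdist_image_le[OF lip ne, of b'] near'[OF b'(1)] by simp
  qed
  show "0 \<le> D" "D \<le> 16 * \<beta>\<^sup>2"
    unfolding D using ne T 1 2 by (intro hausdorff_dist_bounds; blast)+
qed

theorem theorem4p1:
  shows "((\<lambda>\<beta>. hausdorff_dist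
              ((\<lambda>z. im_scale z (inverse (2 * \<beta>))) ` casteljau_attractor \<beta>)
              takagi_graph) \<longlongrightarrow> 0)
         (at (0::real) within {\<beta>. \<bar>\<beta>\<bar> < sqrt 3 / 2})"
proof (rule tendsto_sandwich[where f = "\<lambda>_. 0" and h = "\<lambda>\<beta>. 16 * \<beta>\<^sup>2"])
  \<comment> \<open>The punctured filter excludes \<open>\<beta> = 0\<close>, where
    \<open>inverse (2 * \<beta>)\<close> would be the default value 0.\<close>
  have small: "\<forall>\<^sub>F \<beta> in at (0::real) within {\<beta>. \<bar>\<beta>\<bar> < sqrt 3 / 2}. \<beta> \<noteq> 0 \<and> \<bar>\<beta>\<bar> \<le> 1 / 4"
    unfolding eventually_at by (rule exI[of _ "1 / 4"]) (simp add: dist_norm)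
  show "\<forall>\<^sub>F \<beta> in at (0::real) within {\<beta>. \<bar>\<beta>\<bar> < sqrt 3 / 2}. 0 \<le> hausdorff_dist
      ((\<lambda>z. im_scale z (inverse (2 * \<beta>))) ` casteljau_attractor \<beta>) takagi_graph"
    using small by (rule eventually_mono) (elim conjE, rule hausdorff_dist_casteljau_takagi(1))
  show "\<forall>\<^sub>F \<beta> in at (0::real) within {\<beta>. \<bar>\<beta>\<bar> < sqrt 3 / 2}. hausdorff_dist
      ((\<lambda>z. im_scale z (inverse (2 * \<beta>))) ` casteljau_attractor \<beta>) takagi_graph \<le> 16 * \<beta>\<^sup>2"
    using small by (rule eventually_mono) (elim conjE, rule hausdorff_dist_casteljau_takagi(2))
  have "((\<lambda>\<beta>. 16 * \<beta>\<^sup>2) \<longlongrightarrow> 16 * 0\<^sup>2) (at (0::real) within {\<beta>. \<bar>\<beta>\<bar> < sqrt 3 / 2})"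
    by (intro tendsto_intros)
  then show "((\<lambda>\<beta>. 16 * \<beta>\<^sup>2) \<longlongrightarrow> 0) (at (0::real) within {\<beta>. \<bar>\<beta>\<bar> < sqrt 3 / 2})" by simp
qed simp

end
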